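(* Let $R$ be a ring and ${}_RA$ a simple (left) $R$-module, and let $\mathcal{C}$ be the clone of term operations of ${}_RA$. Then $\mathcal{C}$ is $4$-ultraclosed, i.e. $\Upsilon_4(\mathcal{C})=\mathcal{C}$, and hence $\mathcal{C}$ is also ultralocally closed, i.e. $\Upsilon_\omega(\mathcal{C})=\mathcal{C}$.
   Context: A clone on a nonempty set $A$ is a set of finitary operations on $A$ that contains all projections and is closed under composition. The clone of a module ${}_RA$ is the clone of term operations of the algebra $\langle A;+,-,0,(r\cdot)_{r\in R}\rangle$, i.e. all operations $(x_1,\dots,x_n)\mapsto r_1x_1+\dots+r_nx_n$ with $r_i\in R$. For an ultrafilter $\mathcal{U}$ on a nonempty set $I$, $A^I/\mathcal{U}$ is the ultrapower; for an operation $f$ on $A$, $f_{\mathcal{U}}$ is the operation on $A^I/\mathcal{U}$ induced by applying $f$ coordinatewise, and $\mathcal{C}_{\mathcal{U}}=\{t_{\mathcal{U}}:t\in\mathcal{C}\}$. For a cardinal $\lambda$, an $n$-ary operation $g$ on a set $X$ is $\lambda$-interpolable by a clone $\mathcal{D}$ on $X$ if for every $S\subseteq X^n$ with $|S|\le\lambda$ there is an $n$-ary $t\in\mathcal{D}$ with $g|_S=t|_S$; $f$ is $\lambda$-ultrainterpolable by $\mathcal{C}$ if $f_{\mathcal{U}}$ is $\lambda$-interpolable by $\mathcal{C}_{\mathcal{U}}$ for every ultrafilter $\mathcal{U}$ on every nonempty set $I$. For a nonzero cardinal $\kappa$, $\Upsilon_\kappa(\mathcal{C})$ is the set of all finitary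 operations on $A$ that are $\lambda$-ultrainterpolable by $\mathcal{C}$ for every cardinal $\lambda<\kappa$; $\mathcal{C}$ is $\kappa$-ultraclosed if $\Upsilon_\kappa(\mathcal{C})=\mathcal{C}$, and ultralocally closed if it is $\omega$-ultraclosed. *)

theory Defs
  imports Complex_Main "HOL-Library.FuncSet"
begin

unbundle cardinal_syntax

section \<open>Finitary operations and clones\<close>

text \<open>
  An \<open>n\<close>-ary operation on \<open>X\<close> is a function on the lists of length \<open>n\<close> over \<open>X\<close>, with the default
  value of \<^const>\<open>extensional\<close> functions elsewhere, so that equality of operations is equality of
  functions. Sets of operations of all arities consist of pairs \<open>(n, f)\<close>; the arity \<open>n = 0\<close> is
  included.
\<close>

definition tuples :: "'x set \<Rightarrow> nat \<Rightarrow> 'x list set" where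
  "tuples X n = {xs. length xs = n \<and> set xs \<subseteq> X}"

definition operations :: "'x set \<Rightarrow> nat \<Rightarrow> ('x list \<Rightarrow> 'x) set" where
  "operations X n = tuples X n \<rightarrow>\<^sub>E X"

type_synonym 'x ops = "(nat \<times> ('x list \<Rightarrow> 'x)) set"

inductive_set term_ops :: "'x set \<Rightarrow> 'x ops \<Rightarrow> 'x ops" for X F where
  proj: "i < n \<Longrightarrow> (n, \<lambda>xs\<in>tuples X n. xs ! i) \<in> term_ops X F"
| comp: "(length gs, f) \<in> F \<Longrightarrow> \<forall>g\<in>set gs. (n, g) \<in> term_ops X F \<Longrightarrow>
    (n, \<lambda>xs\<in>tuples X n. f (map (\<lambda>g. g xs) gs)) \<in> term_ops X F"


section \<open>Modules\<close>

text \<open>\<^locale>\<open>module\<close> is restricted to commutative rings.\<close>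

locale left_module =
  fixes scale :: "'r::ring_1 \<Rightarrow> 'a::ab_group_add \<Rightarrow> 'a" (infixr \<open>*s\<close> 75)
  assumes scale_right_distrib: "r *s (x + y) = r *s x + r *s y"
    and scale_left_distrib: "(r + s) *s x = r *s x + s *s x"
    and scale_scale: "r *s (s *s x) = (r * s) *s x"
    and scale_one: "1 *s x = x"
begin

definition submodule :: "'a set \<Rightarrow> bool" where
  "submodule B \<longleftrightarrow> 0 \<in> B \<and> (\<forall>x\<in>B. \<forall>y\<in>B. x + y \<in> B) \<and> (\<forall>r. \<forall>x\<in>B. r *s x \<in> B)"

end

locale simple_left_module = left_module scale
  for scale :: "'r::ring_1 \<Rightarrow> 'a::ab_group_add \<Rightarrow> 'a" (infixr \<open>*s\<close> 75) +
  assumes nonzero: "(UNIV :: 'a set) \<noteq> {0}"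
    and simple: "submodule B \<Longrightarrow> B = {0} \<or> B = UNIV"

definition module_basic_ops :: "('r::ring_1 \<Rightarrow> 'a::ab_group_add \<Rightarrow> 'a) \<Rightarrow> 'a ops" where
  "module_basic_ops scale =
     {(2, \<lambda>xs\<in>tuples UNIV 2. xs ! 0 + xs ! 1),
      (1, \<lambda>xs\<in>tuples UNIV 1. - (xs ! 0)),
      (0, \<lambda>xs\<in>tuples UNIV 0. 0)}
     \<union> {(1, \<lambda>xs\<in>tuples UNIV 1. scale r (xs ! 0)) | r. True}"

definition module_clone :: "('r::ring_1 \<Rightarrow> 'a::ab_group_add \<Rightarrow> 'a) \<Rightarrow> 'a ops" where
  "module_clone scale = term_ops UNIV (module_basic_ops scale)"


section \<open>Ultrapowers\<close>

definition ultrafilter_on :: "'i set \<Rightarrow> 'i set set \<Rightarrow> bool" where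
  "ultrafilter_on I U \<longleftrightarrow> U \<subseteq> Pow I \<and> I \<in> U \<and> {} \<notin> U
     \<and> (\<forall>X\<in>U. \<forall>Y\<in>U. X \<inter> Y \<in> U)
     \<and> (\<forall>X\<in>U. \<forall>Y. X \<subseteq> Y \<and> Y \<subseteq> I \<longrightarrow> Y \<in> U)
     \<and> (\<forall>X. X \<subseteq> I \<longrightarrow> X \<in> U \<or> I - X \<in> U)"

definition ultra_rel :: "'i set \<Rightarrow> 'i set set \<Rightarrow> 'a set \<Rightarrow> ('i \<Rightarrow> 'a) rel" where
  "ultra_rel I U A =
     {(a, b). a \<in> I \<rightarrow>\<^sub>E A \<and> b \<in> I \<rightarrow>\<^sub>E A \<and> {i \<in> I. a i = b i} \<in> U}"

definition ultrapower :: "'i set \<Rightarrow> 'i set set \<Rightarrow> 'a set \<Rightarrow> ('i \<Rightarrow> 'a) set set" where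
  "ultrapower I U A = (I \<rightarrow>\<^sub>E A) // ultra_rel I U A"

text \<open>
  The union over all tuples of representatives is the usual way to define a function on a quotient:
  all its members are the same class (see \<open>ultra_op_classes\<close> below).
\<close>

definition ultra_op ::
  "'i set \<Rightarrow> 'i set set \<Rightarrow> 'a set \<Rightarrow> nat \<Rightarrow> ('a list \<Rightarrow> 'a) \<Rightarrow> (('i \<Rightarrow> 'a) set list \<Rightarrow> ('i \<Rightarrow> 'a) set)" where
  "ultra_op I U A n f =
     (\<lambda>Qs\<in>tuples (ultrapower I U A) n.
        \<Union>as\<in>listset Qs. ultra_rel I U A `` {\<lambda>i\<in>I. f (map (\<lambda>a. a i) as)})"

definition ultra_ops :: "'i set \<Rightarrow> 'i set set \<Rightarrow> 'a set \<Rightarrow> 'a ops \<Rightarrow> ('i \<Rightarrow> 'a) set ops" where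
  "ultra_ops I U A C = {(n, ultra_op I U A n t) | n t. (n, t) \<in> C}"


section \<open>Ultrainterpolation\<close>

text \<open>Cardinals are the cardinal orders of HOL; \<open>|S| \<le>o lam\<close> relates cardinals over different types.\<close>

definition interpolable ::
  "'k rel \<Rightarrow> 'x set \<Rightarrow> 'x ops \<Rightarrow> nat \<Rightarrow> ('x list \<Rightarrow> 'x) \<Rightarrow> bool" where
  "interpolable lam X D n g \<longleftrightarrow>
     (\<forall>S. S \<subseteq> tuples X n \<and> |S| \<le>o lam \<longrightarrow> (\<exists>t. (n, t) \<in> D \<and> (\<forall>xs\<in>S. g xs = t xs)))"

text \<open>
  HOL cannot quantify over all sets \<open>I\<close> of all types inside a formula. The argument \<open>TYPE('i)\<close> is
  the universe from which the index sets are taken. For finite \<open>lam\<close> every universe that is at least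
  as large as the type of lists over \<open>A\<close> gives the notion in which \<open>I\<close> ranges over all nonempty
  sets of all types: this is \<open>ultrainterpolable_index_type\<close> below.
\<close>

definition ultrainterpolable ::
  "'i itself \<Rightarrow> 'k rel \<Rightarrow> 'a set \<Rightarrow> 'a ops \<Rightarrow> nat \<Rightarrow> ('a list \<Rightarrow> 'a) \<Rightarrow> bool" where
  "ultrainterpolable _ lam A C n f \<longleftrightarrow>
     (\<forall>(I :: 'i set) U. I \<noteq> {} \<and> ultrafilter_on I U \<longrightarrow>
        interpolable lam (ultrapower I U A) (ultra_ops I U A C) n (ultra_op I U A n f))"

text \<open>Every cardinal below \<open>\<kappa>\<close> is represented by a cardinal order on the type of \<open>\<kappa>\<close>.\<close>

definition Upsilon :: "'i itself \<Rightarrow> 'k rel \<Rightarrow> 'a set \<Rightarrow> 'a ops \<Rightarrow> 'a ops" where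
  "Upsilon ind \<kappa> A C =
     {(n, f). f \<in> operations A n \<and>
        (\<forall>lam :: 'k rel. Card_order lam \<and> lam <o \<kappa> \<longrightarrow> ultrainterpolable ind lam A C n f)}"

definition ultraclosed :: "'i itself \<Rightarrow> 'k rel \<Rightarrow> 'a set \<Rightarrow> 'a ops \<Rightarrow> bool" where
  "ultraclosed ind \<kappa> A C \<longleftrightarrow> Upsilon ind \<kappa> A C = C"

definition ultralocally_closed :: "'i itself \<Rightarrow> 'a set \<Rightarrow> 'a ops \<Rightarrow> bool" where
  "ultralocally_closed ind A C \<longleftrightarrow> ultraclosed ind natLeq A C"


section \<open>Basic facts\<close>

lemma (in left_module) scale_zero_right: "r *s 0 = 0"
  using scale_right_distrib[of r 0 0] by simp

lemma (in left_module) scale_zero_left: "0 *s x = 0"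
  using scale_left_distrib[of 0 0 x] by simp

lemma (in left_module) scale_minus_left: "(- r) *s x = - (r *s x)"
  using scale_left_distrib[of r "- r" x] by (simp add: scale_zero_left minus_unique)

lemma (in left_module) scale_sum_right: "r *s (\<Sum>i\<in>K. g i) = (\<Sum>i\<in>K. r *s g i)"
  by (induction K rule: infinite_finite_induct) (simp_all add: scale_zero_right scale_right_distrib)

lemma term_ops_compI:
  assumes "(m, f) \<in> F" "length gs = m" "\<forall>g\<in>set gs. (n, g) \<in> term_ops X F"
    "\<And>xs. xs \<in> tuples X n \<Longrightarrow> h xs = f (map (\<lambda>g. g xs) gs)"
  shows "(n, restrict h (tuples X n)) \<in> term_ops X F"
proof -
  have "restrict h (tuples X n) = (\<lambda>xs\<in>tuples X n. f (map (\<lambda>g. g xs) gs))"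
    using assms(4) by (intro restrict_ext)
  then show ?thesis using term_ops.comp[of gs f F n X] assms(1-3) by simp
qed

lemma (in left_module) module_clone_iff:
  "(n, f) \<in> module_clone scale \<longleftrightarrow>
     (\<exists>r. f = (\<lambda>xs\<in>tuples UNIV n. \<Sum>i<n. r i *s (xs ! i)))"
proof
  assume "(n, f) \<in> module_clone scale"
  then show "\<exists>r. f = (\<lambda>xs\<in>tuples UNIV n. \<Sum>i<n. r i *s (xs ! i))"
    unfolding module_clone_def
  proof (induction rule: term_ops.induct)
    case (proj i n)
    have "(\<Sum>j<n. (if j = i then 1 else 0) *s (xs ! j)) = xs ! i" for xs
    proof -
      have "(\<Sum>j<n. (if j = i then 1 else 0) *s (xs ! j)) = (\<Sum>j<n. if j = i then xs ! j else 0)"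
        by (rule sum.cong) (auto simp: scale_one scale_zero_left)
      then show ?thesis using proj by simp
    qed
    then show ?case by (intro exI[of _ "\<lambda>j. if j = i then 1 else 0"]) simp
  next
    case (comp gs f n)
    let ?lin = "\<lambda>n r. (\<lambda>xs\<in>tuples UNIV n. \<Sum>i<n. r i *s (xs ! i))"
    have IH: "\<exists>r. g = ?lin n r" if "g \<in> set gs" for g
      using comp that by blast
    consider (add) "length gs = 2" "f = (\<lambda>xs\<in>tuples UNIV 2. xs ! 0 + xs ! 1)"
      | (neg) "length gs = 1" "f = (\<lambda>xs\<in>tuples UNIV 1. - (xs ! 0))"
      | (zero) "length gs = 0" "f = (\<lambda>xs\<in>tuples UNIV 0. 0)"
      | (scl) r where "length gs = 1" "f = (\<lambda>xs\<in>tuples UNIV 1. scale r (xs ! 0))"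
      using comp(1) unfolding module_basic_ops_def by auto
    then show ?case
    proof cases
      case add
      then obtain g h where gs: "gs = [g, h]"
        by (auto simp: numeral_2_eq_2 length_Suc_conv)
      obtain r s where "g = ?lin n r" "h = ?lin n s" using IH[of g] IH[of h] gs by auto
      then show ?thesis using add gs
        by (intro exI[of _ "\<lambda>i. r i + s i"] ext)
          (auto simp: tuples_def scale_left_distrib sum.distrib restrict_def)
    next
      case neg
      then obtain g where gs: "gs = [g]" by (auto simp: length_Suc_conv)
      then obtain r where "g = ?lin n r" using IH by auto
      then show ?thesis using neg gs
        by (intro exI[of _ "\<lambda>i. - r i"] ext)
          (auto simp: tuples_def scale_minus_left sum_negf restrict_def)
    next
      case zero
      then show ?thesis
        by (intro exI[of _ "\<lambda>i. 0"] ext) (auto simp: tuples_def scale_zero_left restrict_def)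
    next
      case scl
      then obtain g where gs: "gs = [g]" by (auto simp: length_Suc_conv)
      then obtain s where "g = ?lin n s" using IH by auto
      then show ?thesis using scl gs
        by (intro exI[of _ "\<lambda>i. r * s i"] ext)
          (auto simp: tuples_def scale_sum_right scale_scale restrict_def)
    qed
  qed
next
  assume "\<exists>r. f = (\<lambda>xs\<in>tuples UNIV n. \<Sum>i<n. r i *s (xs ! i))"
  then obtain r where f: "f = (\<lambda>xs\<in>tuples UNIV n. \<Sum>i<n. r i *s (xs ! i))" by blast
  have "m \<le> n \<Longrightarrow> (n, \<lambda>xs\<in>tuples UNIV n. \<Sum>i<m. r i *s (xs ! i)) \<in> module_clone scale" for m
  proof (induction m)
    case 0
    have "(0, \<lambda>xs\<in>tuples UNIV 0. 0) \<in> module_basic_ops scale"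
      by (simp add: module_basic_ops_def)
    then show ?case
      unfolding module_clone_def by (rule term_ops_compI[where gs = "[]"]) (auto simp: tuples_def)
  next
    case (Suc m)
    let ?g = "\<lambda>xs\<in>tuples UNIV n. \<Sum>i<m. r i *s (xs ! i)"
    let ?p = "\<lambda>xs\<in>tuples UNIV n. xs ! m"
    let ?s = "\<lambda>xs\<in>tuples UNIV n. r m *s (xs ! m)"
    have p: "(n, ?p) \<in> module_clone scale"
      unfolding module_clone_def using Suc.prems by (intro term_ops.proj) simp
    have "(1, \<lambda>xs\<in>tuples UNIV 1. r m *s (xs ! 0)) \<in> module_basic_ops scale"
      unfolding module_basic_ops_def by blast
    then have s: "(n, ?s) \<in> module_clone scale"
      unfolding module_clone_def
      by (rule term_ops_compI[where gs = "[?p]"]) (use p in \<open>auto simp: module_clone_def tuples_def\<close>)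
    have "(2, \<lambda>xs\<in>tuples UNIV 2. xs ! 0 + xs ! 1) \<in> module_basic_ops scale"
      unfolding module_basic_ops_def by blast
    then show ?case
      unfolding module_clone_def
      by (rule term_ops_compI[where gs = "[?g, ?s]"])
        (use s Suc in \<open>auto simp: module_clone_def tuples_def restrict_def\<close>)
  qed
  then show "(n, f) \<in> module_clone scale" using f by simp
qed

lemma ultrafilter_onD:
  assumes "ultrafilter_on I U"
  shows "X \<in> U \<Longrightarrow> X \<subseteq> I" "I \<in> U" "{} \<notin> U" "X \<in> U \<Longrightarrow> Y \<in> U \<Longrightarrow> X \<inter> Y \<in> U"
    "X \<in> U \<Longrightarrow> X \<subseteq> Y \<Longrightarrow> Y \<subseteq> I \<Longrightarrow> Y \<in> U" "X \<subseteq> I \<Longrightarrow> X \<notin> U \<Longrightarrow> I - X \<in> U"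
proof -
  note U = assms[unfolded ultrafilter_on_def]
  show "X \<in> U \<Longrightarrow> X \<subseteq> I" "I \<in> U" "{} \<notin> U" "X \<in> U \<Longrightarrow> Y \<in> U \<Longrightarrow> X \<inter> Y \<in> U"
    using U by auto
  from U have "\<forall>X\<in>U. \<forall>Y. X \<subseteq> Y \<and> Y \<subseteq> I \<longrightarrow> Y \<in> U" by (elim conjE)
  then show "X \<in> U \<Longrightarrow> X \<subseteq> Y \<Longrightarrow> Y \<subseteq> I \<Longrightarrow> Y \<in> U" by blast
  from U have "\<forall>X. X \<subseteq> I \<longrightarrow> X \<in> U \<or> I - X \<in> U" by (elim conjE)
  then show "X \<subseteq> I \<Longrightarrow> X \<notin> U \<Longrightarrow> I - X \<in> U" by blast
qed

lemma equiv_ultra_rel: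
  assumes U: "ultrafilter_on I U"
  shows "equiv (I \<rightarrow>\<^sub>E A) (ultra_rel I U A)"
proof (rule equivI)
  show "ultra_rel I U A \<subseteq> (I \<rightarrow>\<^sub>E A) \<times> (I \<rightarrow>\<^sub>E A)" by (auto simp: ultra_rel_def)
  show "refl_on (I \<rightarrow>\<^sub>E A) (ultra_rel I U A)"
    using ultrafilter_onD(2)[OF U] by (auto simp: refl_on_def ultra_rel_def)
  show "sym (ultra_rel I U A)" by (auto simp: sym_def ultra_rel_def eq_commute)
  show "trans (ultra_rel I U A)"
  proof (rule transI)
    fix a b c assume ab: "(a, b) \<in> ultra_rel I U A" and bc: "(b, c) \<in> ultra_rel I U A"
    then have "{i \<in> I. a i = b i} \<inter> {i \<in> I. b i = c i} \<in> U"
      using ultrafilter_onD(4)[OF U] by (auto simp: ultra_rel_def)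
    then have "{i \<in> I. a i = c i} \<in> U" by (rule ultrafilter_onD(5)[OF U]) auto
    then show "(a, c) \<in> ultra_rel I U A" using ab bc by (auto simp: ultra_rel_def)
  qed
qed

lemma listset_iff: "as \<in> listset Qs \<longleftrightarrow> list_all2 (\<in>) as Qs"
  by (induction Qs arbitrary: as) (auto simp: set_Cons_def list_all2_Cons2)

lemma ultra_op_coordinatewise_in:
  assumes f: "f \<in> operations A n" and as: "as \<in> tuples (I \<rightarrow>\<^sub>E A) n"
  shows "(\<lambda>i\<in>I. f (map (\<lambda>a. a i) as)) \<in> I \<rightarrow>\<^sub>E A"
proof -
  have "map (\<lambda>a. a i) as \<in> tuples A n" if "i \<in> I" for i
    using as that by (auto simp: tuples_def PiE_def Pi_def subset_iff)
  then show ?thesis using f by (auto simp: operations_def)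
qed

lemma ultra_rel_list:
  assumes U: "ultrafilter_on I U" and "list_all2 (\<lambda>a b. (a, b) \<in> ultra_rel I U A) as bs"
  shows "{i \<in> I. map (\<lambda>a. a i) as = map (\<lambda>b. b i) bs} \<in> U"
  using assms(2)
proof (induction rule: list_all2_induct)
  case Nil
  then show ?case using ultrafilter_onD(2)[OF U] by simp
next
  case (Cons a as b bs)
  have "{i \<in> I. a i = b i} \<inter> {i \<in> I. map (\<lambda>a. a i) as = map (\<lambda>b. b i) bs} \<in> U"
    using Cons ultrafilter_onD(4)[OF U] by (auto simp: ultra_rel_def)
  then show ?case by (rule ultrafilter_onD(5)[OF U]) auto
qed

lemma ultra_op_classes:
  assumes U: "ultrafilter_on I U" and f: "f \<in> operations A n"
    and as: "as \<in> tuples (I \<rightarrow>\<^sub>E A) n"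
  shows "ultra_op I U A n f (map (\<lambda>a. ultra_rel I U A `` {a}) as) =
    ultra_rel I U A `` {\<lambda>i\<in>I. f (map (\<lambda>a. a i) as)}"
proof -
  let ?Qs = "map (\<lambda>a. ultra_rel I U A `` {a}) as"
  let ?v = "\<lambda>as. \<lambda>i\<in>I. f (map (\<lambda>a. a i) as)"
  note eq = equiv_ultra_rel[OF U, of A]
  have Qs: "?Qs \<in> tuples (ultrapower I U A) n"
    using as by (auto simp: tuples_def ultrapower_def intro: quotientI)
  have mem: "as \<in> listset ?Qs"
  proof -
    have "a \<in> ultra_rel I U A `` {a}" if "a \<in> set as" for a
      using that as equiv_class_self[OF eq] by (auto simp: tuples_def)
    then show ?thesis by (simp add: listset_iff list_all2_conv_all_nth)
  qed
  have same: "ultra_rel I U A `` {?v bs} = ultra_rel I U A `` {?v as}" if "bs \<in> listset ?Qs" for bs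
  proof -
    have l: "list_all2 (\<lambda>a b. (a, b) \<in> ultra_rel I U A) as bs"
      using that by (auto simp: listset_iff list_all2_conv_all_nth)
    then have "length bs = n" using as by (auto simp: tuples_def dest: list_all2_lengthD)
    moreover have "set bs \<subseteq> I \<rightarrow>\<^sub>E A"
    proof
      fix b assume "b \<in> set bs"
      then obtain k where "k < length bs" "b = bs ! k" by (auto simp: in_set_conv_nth)
      with l have "(as ! k, b) \<in> ultra_rel I U A" by (auto simp: list_all2_conv_all_nth)
      then show "b \<in> I \<rightarrow>\<^sub>E A" by (simp add: ultra_rel_def)
    qed
    ultimately have bs: "bs \<in> tuples (I \<rightarrow>\<^sub>E A) n" by (auto simp: tuples_def)
    have "{i \<in> I. ?v as i = ?v bs i} \<in> U"
      by (rule ultrafilter_onD(5)[OF U ultra_rel_list[OF U l]]) auto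
    then have "(?v as, ?v bs) \<in> ultra_rel I U A"
      using ultra_op_coordinatewise_in[OF f as] ultra_op_coordinatewise_in[OF f bs]
      by (simp add: ultra_rel_def)
    then show ?thesis using equiv_class_eq[OF eq] by blast
  qed
  have "ultra_op I U A n f ?Qs = (\<Union>bs\<in>listset ?Qs. ultra_rel I U A `` {?v bs})"
    using Qs by (simp add: ultra_op_def)
  also have "\<dots> = ultra_rel I U A `` {?v as}" using same mem by blast
  finally show ?thesis .
qed

lemma ultra_op_eq_iff:
  assumes U: "ultrafilter_on I U" and f: "f \<in> operations A n" and t: "t \<in> operations A n"
    and as: "as \<in> tuples (I \<rightarrow>\<^sub>E A) n"
  defines "Qs \<equiv> map (\<lambda>a. ultra_rel I U A `` {a}) as"
  shows "ultra_op I U A n f Qs = ultra_op I U A n t Qs \<longleftrightarrow>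
    {i \<in> I. f (map (\<lambda>a. a i) as) = t (map (\<lambda>a. a i) as)} \<in> U"
proof -
  let ?v = "\<lambda>f. \<lambda>i\<in>I. f (map (\<lambda>a. a i) as)"
  have "ultra_op I U A n f Qs = ultra_op I U A n t Qs \<longleftrightarrow> (?v f, ?v t) \<in> ultra_rel I U A"
    unfolding Qs_def ultra_op_classes[OF U f as] ultra_op_classes[OF U t as]
    using eq_equiv_class_iff[OF equiv_ultra_rel[OF U] ultra_op_coordinatewise_in[OF f as]
        ultra_op_coordinatewise_in[OF t as]] .
  also have "{i \<in> I. ?v f i = ?v t i} = {i \<in> I. f (map (\<lambda>a. a i) as) = t (map (\<lambda>a. a i) as)}"
    by auto
  then have "(?v f, ?v t) \<in> ultra_rel I U A \<longleftrightarrow>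
      {i \<in> I. f (map (\<lambda>a. a i) as) = t (map (\<lambda>a. a i) as)} \<in> U"
    using ultra_op_coordinatewise_in[OF f as] ultra_op_coordinatewise_in[OF t as]
    by (simp add: ultra_rel_def)
  finally show ?thesis .
qed

lemma tuples_ultrapower_reps:
  assumes "Qs \<in> tuples (ultrapower I U A) n"
  shows "\<exists>as\<in>tuples (I \<rightarrow>\<^sub>E A) n. Qs = map (\<lambda>a. ultra_rel I U A `` {a}) as"
proof -
  have "\<exists>a. a \<in> I \<rightarrow>\<^sub>E A \<and> Q = ultra_rel I U A `` {a}" if "Q \<in> set Qs" for Q
    using assms that by (auto simp: tuples_def ultrapower_def quotient_def)
  then obtain c where c: "\<And>Q. Q \<in> set Qs \<Longrightarrow> c Q \<in> I \<rightarrow>\<^sub>E A \<and> Q = ultra_rel I U A `` {c Q}"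
    by metis
  show ?thesis
  proof
    show "map c Qs \<in> tuples (I \<rightarrow>\<^sub>E A) n" using assms c by (auto simp: tuples_def)
    have "map (\<lambda>Q. ultra_rel I U A `` {c Q}) Qs = map (\<lambda>Q. Q) Qs"
      using c by (intro map_cong) auto
    then show "Qs = map (\<lambda>a. ultra_rel I U A `` {a}) (map c Qs)" by (simp add: comp_def)
  qed
qed

lemma ultrainterpolable_index_type:
  fixes A :: "'a set" and lam :: "'k rel"
  assumes large: "|UNIV :: 'a list set| \<le>o |UNIV :: 'i set|"
    and lam: "Card_order lam" and fin: "finite (Field lam)"
    and C: "\<And>m t. (m, t) \<in> C \<Longrightarrow> t \<in> operations A m" and f: "f \<in> operations A n"
    and ui: "ultrainterpolable TYPE('i) lam A C n f"
  shows "ultrainterpolable TYPE('j) lam A C n f"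
  unfolding ultrainterpolable_def interpolable_def
proof (intro allI impI, elim conjE)
  fix J :: "'j set" and V and S :: "('j \<Rightarrow> 'a) set list set"
  assume J: "J \<noteq> {}" and V: "ultrafilter_on J V"
    and S: "S \<subseteq> tuples (ultrapower J V A) n" and cS: "|S| \<le>o lam"
  have finS: "finite S"
  proof -
    have "|S| \<le>o |Field lam|"
      by (rule ordLeq_ordIso_trans[OF cS ordIso_symmetric[OF card_of_Field_ordIso[OF lam]]])
    then show ?thesis using fin by (rule card_of_ordLeq_finite)
  qed
  have "\<forall>Qs\<in>S. \<exists>as. as \<in> tuples (J \<rightarrow>\<^sub>E A) n \<and> Qs = map (\<lambda>a. ultra_rel J V A `` {a}) as"
    using tuples_ultrapower_reps S by blast
  from bchoice[OF this] obtain rep where rep: "\<And>Qs. Qs \<in> S \<Longrightarrow> rep Qs \<in> tuples (J \<rightarrow>\<^sub>E A) n"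
    and rep_eq: "\<And>Qs. Qs \<in> S \<Longrightarrow> Qs = map (\<lambda>a. ultra_rel J V A `` {a}) (rep Qs)"
    by blast
  obtain fs where fs: "set fs = (\<Union>Qs\<in>S. set (rep Qs))"
    using finite_list[of "\<Union>Qs\<in>S. set (rep Qs)"] finS by auto
  obtain e :: "'a list \<Rightarrow> 'i" where e: "inj e"
    using large by (auto simp: card_of_ordLeq[symmetric])
  define h where "h j = e (map (\<lambda>a. a j) fs)" for j
  define I where "I = h ` J"
  define U where "U = {Y. Y \<subseteq> I \<and> {j \<in> J. h j \<in> Y} \<in> V}"
  define g where "g i = (SOME j. j \<in> J \<and> h j = i)" for i
  define pr where "pr a = (\<lambda>i\<in>I. a (g i))" for a :: "'j \<Rightarrow> 'a"
  have g: "g i \<in> J" "h (g i) = i" if "i \<in> I" for i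
    using that someI_ex[of "\<lambda>j. j \<in> J \<and> h j = i"] unfolding g_def I_def by blast+
  have pr_h: "pr a (h j) = a j" if "a \<in> set fs" "j \<in> J" for a j
  proof -
    have "h (g (h j)) = h j" using g that by (auto simp: I_def)
    then have "map (\<lambda>a. a (g (h j))) fs = map (\<lambda>a. a j) fs"
      unfolding h_def by (rule injD[OF e])
    then have "a (g (h j)) = a j" using that by (simp add: map_eq_conv)
    then show ?thesis using that by (simp add: pr_def I_def)
  qed
  have I: "I \<noteq> {}" using J by (simp add: I_def)
  have U: "ultrafilter_on I U"
    unfolding ultrafilter_on_def
  proof (intro conjI ballI allI impI)
    show "U \<subseteq> Pow I" by (auto simp: U_def)
    have "{j \<in> J. h j \<in> I} = J" by (auto simp: I_def)
    then show "I \<in> U" using ultrafilter_onD(2)[OF V] by (simp add: U_def)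
    show "{} \<notin> U" using ultrafilter_onD(3)[OF V] by (simp add: U_def)
  next
    fix X Y assume "X \<in> U" "Y \<in> U"
    moreover have "{j \<in> J. h j \<in> X \<inter> Y} = {j \<in> J. h j \<in> X} \<inter> {j \<in> J. h j \<in> Y}" by auto
    ultimately show "X \<inter> Y \<in> U" using ultrafilter_onD(4)[OF V] by (auto simp: U_def)
  next
    fix X Y assume "X \<in> U" and Y: "X \<subseteq> Y \<and> Y \<subseteq> I"
    then have "{j \<in> J. h j \<in> X} \<in> V" by (simp add: U_def)
    then have "{j \<in> J. h j \<in> Y} \<in> V" by (rule ultrafilter_onD(5)[OF V]) (use Y in auto)
    then show "Y \<in> U" using Y by (simp add: U_def)
  next
    fix X assume X: "X \<subseteq> I"
    have "J - {j \<in> J. h j \<in> X} = {j \<in> J. h j \<in> I - X}" by (auto simp: I_def)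
    then show "X \<in> U \<or> I - X \<in> U"
      using X ultrafilter_onD(6)[OF V, of "{j \<in> J. h j \<in> X}"] by (auto simp: U_def)
  qed
  define tr where "tr Qs = map (\<lambda>a. ultra_rel I U A `` {a}) (map pr (rep Qs))" for Qs
  have prep: "map pr (rep Qs) \<in> tuples (I \<rightarrow>\<^sub>E A) n" if "Qs \<in> S" for Qs
  proof -
    have "pr a \<in> I \<rightarrow>\<^sub>E A" if "a \<in> J \<rightarrow>\<^sub>E A" for a
      using that g(1) by (auto simp: pr_def)
    then show ?thesis using rep[OF that] by (auto simp: tuples_def)
  qed
  have trS: "tr ` S \<subseteq> tuples (ultrapower I U A) n"
  proof
    fix Rs assume "Rs \<in> tr ` S"
    then obtain Qs where "Qs \<in> S" "Rs = tr Qs" by blast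
    then show "Rs \<in> tuples (ultrapower I U A) n"
      using prep[of Qs] by (auto simp: tuples_def tr_def ultrapower_def intro: quotientI)
  qed
  have "|tr ` S| \<le>o lam" using card_of_image cS ordLeq_transitive by blast
  moreover have "interpolable lam (ultrapower I U A) (ultra_ops I U A C) n (ultra_op I U A n f)"
    using ui I U by (simp add: ultrainterpolable_def)
  ultimately obtain t' where t': "(n, t') \<in> ultra_ops I U A C"
    "\<forall>Rs\<in>tr ` S. ultra_op I U A n f Rs = t' Rs"
    using trS unfolding interpolable_def by (elim allE[of _ "tr ` S"]) auto
  then obtain t where tC: "(n, t) \<in> C" and t: "\<forall>Qs\<in>S. ultra_op I U A n f (tr Qs) = ultra_op I U A n t (tr Qs)"
    by (auto simp: ultra_ops_def)
  have "ultra_op J V A n f Qs = ultra_op J V A n t Qs" if Q: "Qs \<in> S" for Qs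
  proof -
    let ?E = "{i \<in> I. f (map (\<lambda>a. a i) (map pr (rep Qs))) = t (map (\<lambda>a. a i) (map pr (rep Qs)))}"
    have "?E \<in> U"
      using t Q ultra_op_eq_iff[OF U f C[OF tC] prep[OF Q]] by (simp add: tr_def)
    then have E: "{j \<in> J. h j \<in> ?E} \<in> V" by (simp add: U_def)
    have "map (\<lambda>a. a (h j)) (map pr (rep Qs)) = map (\<lambda>a. a j) (rep Qs)" if "j \<in> J" for j
      using pr_h[OF _ that] fs Q by auto
    then have "{j \<in> J. f (map (\<lambda>a. a j) (rep Qs)) = t (map (\<lambda>a. a j) (rep Qs))} \<in> V"
      by (intro ultrafilter_onD(5)[OF V E]) (auto simp del: map_map)
    then show ?thesis
      using ultra_op_eq_iff[OF V f C[OF tC] rep[OF Q]] rep_eq[OF Q] by simp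
  qed
  then show "\<exists>t. (n, t) \<in> ultra_ops J V A C \<and> (\<forall>Qs\<in>S. ultra_op J V A n f Qs = t Qs)"
    using tC by (auto simp: ultra_ops_def)
qed

end

theory Submission
  imports Defs
begin

text \<open>
  By compactness (an ultrafilter extending a family with the finite intersection property), an
  operation \<open>f\<close> that is \<open>3\<close>-ultrainterpolable by the clone is interpolated at any three points by a
  member of one fixed finite set \<open>T\<close> of term operations. Interpolation at \<open>x, y, x + y\<close> makes \<open>f\<close>
  additive, which reduces the problem to unary \<open>f\<close> with \<open>T\<close> a finite set of scalars, and
  interpolation at \<open>x, d x\<close> makes \<open>f\<close> commute with every endomorphism \<open>d\<close> of the module. If \<open>T\<close> is
  chosen minimal, the subgroups \<open>ker (f - s)\<close> for \<open>s \<in> T\<close> form an irredundant cover of \<open>A\<close>, so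
  their intersection has finite index. Fix \<open>r\<^sub>0 \<in> T\<close>. All \<open>s - r\<^sub>0\<close> then have finite image, and
  \<open>f - r\<^sub>0\<close> vanishes on the intersection of their kernels; the argument of the Jacobson density
  theorem writes such a map as a left combination of the \<open>s - r\<^sub>0\<close>.
\<close>

section \<open>Ultrafilters\<close>

definition fip :: "'i set set \<Rightarrow> bool" where
  "fip G \<longleftrightarrow> (\<forall>H. finite H \<and> H \<subseteq> G \<longrightarrow> \<Inter>H \<noteq> {})"

lemma fip_chain_Union:
  assumes "subset.chain {G. fip G} \<C>" "\<C> \<noteq> {}"
  shows "fip (\<Union>\<C>)"
  unfolding fip_def
proof (intro allI impI, elim conjE)
  fix H assume "finite H" "H \<subseteq> \<Union>\<C>"
  then obtain G where "G \<in> \<C>" "H \<subseteq> G"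
    using finite_subset_Union_chain[OF _ _ assms(2,1)] by blast
  moreover have "fip G" using assms(1) \<open>G \<in> \<C>\<close> by (auto simp: subset.chain_def)
  ultimately show "\<Inter>H \<noteq> {}" using \<open>finite H\<close> by (auto simp: fip_def)
qed

text \<open>Zorn's lemma gives a maximal family with the finite intersection property above
  \<open>G\<close>; maximality forces the filter laws and the dichotomy between a set and its
  complement.\<close>

lemma fip_extends_to_ultrafilter:
  fixes G :: "'i set set"
  assumes "fip G"
  shows "\<exists>U. G \<subseteq> U \<and> ultrafilter_on UNIV U"
proof -
  have "\<exists>U\<in>{X. fip X \<and> G \<subseteq> X}. \<forall>X\<in>{X. fip X \<and> G \<subseteq> X}. U \<subseteq> X \<longrightarrow> X = U"
  proof (rule subset_Zorn_nonempty)
    show "{X. fip X \<and> G \<subseteq> X} \<noteq> {}" using assms by auto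
  next
    fix \<C> assume *: "\<C> \<noteq> {}" "subset.chain {X. fip X \<and> G \<subseteq> X} \<C>"
    then have "subset.chain {G. fip G} \<C>" by (auto simp: subset.chain_def)
    then have "fip (\<Union>\<C>)" using fip_chain_Union *(1) by blast
    moreover have "G \<subseteq> \<Union>\<C>" using * by (fastforce simp: subset.chain_def)
    ultimately show "\<Union>\<C> \<in> {X. fip X \<and> G \<subseteq> X}" by simp
  qed
  then obtain U where fU: "fip U" and GU: "G \<subseteq> U"
    and max': "\<forall>X. fip X \<and> G \<subseteq> X \<longrightarrow> U \<subseteq> X \<longrightarrow> X = U"
    by auto
  have max: "X = U" if "fip X" "U \<subseteq> X" for X
    using max' that GU by (meson subset_trans)
  \<comment> \<open>A set meeting all finite intersections of \<open>U\<close> can be adjoined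
    without losing the property, so by maximality it is already a member.\<close>
  have mem: "Y \<in> U" if Y: "\<And>H. finite H \<Longrightarrow> H \<subseteq> U \<Longrightarrow> Y \<inter> \<Inter>H \<noteq> {}" for Y
  proof -
    have "fip (insert Y U)"
      unfolding fip_def
    proof (intro allI impI, elim conjE)
      fix H assume "finite H" "H \<subseteq> insert Y U"
      then have "Y \<inter> \<Inter>(H - {Y}) \<noteq> {}" by (intro Y) auto
      then show "\<Inter>H \<noteq> {}" by auto
    qed
    then show ?thesis using max[of "insert Y U"] by blast
  qed
  have above: "Y \<in> U" if "finite K" "K \<subseteq> U" "\<Inter>K \<subseteq> Y" for K Y
  proof (rule mem)
    fix H assume "finite H" "H \<subseteq> U"
    then have "\<Inter>(K \<union> H) \<noteq> {}" using fU that unfolding fip_def by (metis finite_Un Un_least)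
    then show "Y \<inter> \<Inter>H \<noteq> {}" using that(3) by auto
  qed
  have "ultrafilter_on UNIV U"
    unfolding ultrafilter_on_def
  proof (intro conjI ballI allI impI)
    show "UNIV \<in> U" by (rule above[of "{}"]) auto
    show "{} \<notin> U"
      using fU[unfolded fip_def, rule_format, of "{{}}"] by auto
  next
    fix X Y assume "X \<in> U" "Y \<in> U"
    then show "X \<inter> Y \<in> U" by (intro above[of "{X, Y}"]) auto
  next
    fix X Y assume "X \<in> U" "X \<subseteq> Y \<and> Y \<subseteq> UNIV"
    then show "Y \<in> U" by (intro above[of "{X}"]) auto
  next
    fix X :: "'i set"
    show "X \<in> U \<or> UNIV - X \<in> U"
    proof (rule ccontr)
      assume neg: "\<not> ?thesis"
      then obtain H K where "finite H" "H \<subseteq> U" "X \<inter> \<Inter>H = {}"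
        and "finite K" "K \<subseteq> U" "(UNIV - X) \<inter> \<Inter>K = {}"
        using mem[of X] mem[of "UNIV - X"] by blast
      then have "finite (H \<union> K)" "H \<union> K \<subseteq> U" "\<Inter>(H \<union> K) = {}" by (blast, blast, blast)
      then show False using fU unfolding fip_def by blast
    qed
  qed auto
  then show ?thesis using GU by blast
qed


section \<open>Irredundant covers by subgroups\<close>

text \<open>
  For \<open>T' \<subset> T\<close> and \<open>a\<close> outside all \<open>K s\<close> with \<open>s \<in> T'\<close>, translation by \<open>a\<close> moves \<open>\<Inter>s\<in>T'. K s\<close> into the
  union of the remaining \<open>K s\<close>; it is thus a finite union of cosets of intersections over larger
  index sets.
\<close>

lemma irredundant_cover_Inter_finite_index:
  fixes K :: "'s \<Rightarrow> 'a::ab_group_add set"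
  assumes fin: "finite T"
    and zero: "\<And>s. s \<in> T \<Longrightarrow> 0 \<in> K s"
    and diff: "\<And>s x y. s \<in> T \<Longrightarrow> x \<in> K s \<Longrightarrow> y \<in> K s \<Longrightarrow> x - y \<in> K s"
    and cover: "(\<Union>s\<in>T. K s) = UNIV"
    and irred: "\<And>T'. T' \<subset> T \<Longrightarrow> (\<Union>s\<in>T'. K s) \<noteq> UNIV"
  shows "\<exists>F. finite F \<and> (\<forall>x. \<exists>y\<in>F. x - y \<in> (\<Inter>s\<in>T. K s))"
proof -
  \<comment> \<open>The induction runs downwards from \<open>T' = T\<close>, where
    \<open>{0}\<close> suffices; \<open>T' = {}\<close> is the claim.\<close>
  have "\<exists>F. finite F \<and> (\<forall>x\<in>(\<Inter>s\<in>T'. K s). \<exists>y\<in>F. x - y \<in> (\<Inter>s\<in>T. K s))" if "T' \<subseteq> T" for T'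
    using that
  proof (induction "card (T - T')" arbitrary: T' rule: less_induct)
    case less
    show ?case
    proof (cases "T' = T")
      case True
      then show ?thesis by (intro exI[of _ "{0}"]) auto
    next
      case False
      then obtain a where a: "a \<notin> (\<Union>s\<in>T'. K s)" using irred[of T'] less.prems by blast
      have "\<exists>F. finite F \<and> (\<forall>x\<in>(\<Inter>u\<in>insert s T'. K u). \<exists>y\<in>F. x - y \<in> (\<Inter>s\<in>T. K s))"
        if "s \<in> T - T'" for s
      proof (rule less.hyps)
        show "card (T - insert s T') < card (T - T')"
          using that fin by (intro psubset_card_mono) auto
        show "insert s T' \<subseteq> T" using that less.prems by auto
      qed
      then obtain F where F: "\<And>s. s \<in> T - T' \<Longrightarrow> finite (F s)"
        "\<And>s x. s \<in> T - T' \<Longrightarrow> x \<in> (\<Inter>u\<in>insert s T'. K u) \<Longrightarrow> \<exists>y\<in>F s. x - y \<in> (\<Inter>s\<in>T. K s)"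
        by metis
      \<comment> \<open>One translate per \<open>s\<close> keeps the union finite. Any
        \<open>x\<close> that falls into case \<open>s\<close> witnesses the choice, and subtracting
        \<open>c s + a\<close> from \<open>x + a\<close> puts \<open>x - c s\<close> into
        \<open>K s\<close>.\<close>
      define c where "c s = (SOME z. z \<in> (\<Inter>u\<in>T'. K u) \<and> z + a \<in> K s)" for s
      let ?F = "\<Union>s\<in>T - T'. (\<lambda>y. y + c s) ` F s"
      have "\<exists>y\<in>?F. x - y \<in> (\<Inter>s\<in>T. K s)" if x: "x \<in> (\<Inter>u\<in>T'. K u)" for x
      proof -
        obtain s where s: "s \<in> T" "x + a \<in> K s" using cover by blast
        have "s \<notin> T'"
        proof
          assume "s \<in> T'"
          then have "(x + a) - x \<in> K s" using s x by (intro diff) auto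
          then show False using a \<open>s \<in> T'\<close> by auto
        qed
        have c: "c s \<in> (\<Inter>u\<in>T'. K u)" "c s + a \<in> K s"
          using someI[of "\<lambda>z. z \<in> (\<Inter>u\<in>T'. K u) \<and> z + a \<in> K s" x] x s by (auto simp: c_def)
        have "x - c s \<in> K u" if "u \<in> T'" for u
          using that x c less.prems by (intro diff) auto
        moreover have "(x + a) - (c s + a) \<in> K s" using s c by (intro diff)
        ultimately have "x - c s \<in> (\<Inter>u\<in>insert s T'. K u)" by auto
        then obtain y where "y \<in> F s" "x - c s - y \<in> (\<Inter>s\<in>T. K s)"
          using F(2)[of s] s \<open>s \<notin> T'\<close> by blast
        then have "y + c s \<in> ?F" "x - (y + c s) \<in> (\<Inter>s\<in>T. K s)"
          using s \<open>s \<notin> T'\<close> by (auto simp: algebra_simps)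
        then show ?thesis by blast
      qed
      moreover have "finite ?F" using fin F(1) by auto
      ultimately show ?thesis by blast
    qed
  qed
  from this[of "{}"] show ?thesis by auto
qed


section \<open>Density\<close>

context left_module
begin

lemma scale_minus_right: "r *s (- x) = - (r *s x)"
  using scale_right_distrib[of r x "- x"] by (simp add: scale_zero_right minus_unique)

lemma scale_diff_right: "r *s (x - y) = r *s x - r *s y"
  using scale_right_distrib[of r x "- y"] by (simp add: scale_minus_right)

lemma scale_diff_left: "(r - s) *s x = r *s x - s *s x"
  using scale_left_distrib[of r "- s" x] by (simp add: scale_minus_left)

definition endos :: "('a \<Rightarrow> 'a) set" where
  "endos = {d. (\<forall>x y. d (x + y) = d x + d y) \<and> (\<forall>r x. d (r *s x) = r *s d x)}"

lemma endos_add: "d \<in> endos \<Longrightarrow> d (x + y) = d x + d y"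
  and endos_scale: "d \<in> endos \<Longrightarrow> d (r *s x) = r *s d x"
  by (auto simp: endos_def)

lemma endos_zero: "d \<in> endos \<Longrightarrow> d 0 = 0"
  using endos_scale[of d 0 0] by (simp add: scale_zero_left)

lemma endos_diff: "d \<in> endos \<Longrightarrow> d (x - y) = d x - d y"
  using endos_add[of d "x - y" y] by simp

text \<open>These are the submodules over the endomorphism ring; negatives come from
  \<open>uminus\<close>, which lies in \<open>endos\<close>.\<close>

definition endo_subspace :: "'a set \<Rightarrow> bool" where
  "endo_subspace V \<longleftrightarrow>
     0 \<in> V \<and> (\<forall>x\<in>V. \<forall>y\<in>V. x + y \<in> V) \<and> (\<forall>d\<in>endos. \<forall>x\<in>V. d x \<in> V)"

text \<open>These maps form the double centralizer of the scalar multiplications.\<close>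

definition endo_linear :: "('a \<Rightarrow> 'a) \<Rightarrow> bool" where
  "endo_linear g \<longleftrightarrow>
     (\<forall>x y. g (x + y) = g x + g y) \<and> (\<forall>d\<in>endos. \<forall>x. g (d x) = d (g x))"

lemma endo_linear_add: "endo_linear g \<Longrightarrow> g (x + y) = g x + g y"
  and endo_linear_endo: "endo_linear g \<Longrightarrow> d \<in> endos \<Longrightarrow> g (d x) = d (g x)"
  by (auto simp: endo_linear_def)

lemma endo_linear_zero: "endo_linear g \<Longrightarrow> g 0 = 0"
  using endo_linear_add[of g 0 0] by simp

lemma endo_linear_diff: "endo_linear g \<Longrightarrow> g (x - y) = g x - g y"
  using endo_linear_add[of g "x - y" y] by simp

lemma endo_linear_minus_scale:
  assumes "endo_linear g"
  shows "endo_linear (\<lambda>x. g x - r *s x)"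
  using assms unfolding endo_linear_def
  by (auto simp: scale_right_distrib endos_diff endos_scale)

end

context simple_left_module
begin

text \<open>The multiples of \<open>v\<close> by elements of \<open>N\<close> form a nonzero
  submodule, which by simplicity is everything.\<close>

lemma left_ideal_transitive:
  assumes add: "\<And>r s. r \<in> N \<Longrightarrow> s \<in> N \<Longrightarrow> r + s \<in> N"
    and mult: "\<And>r s. s \<in> N \<Longrightarrow> r * s \<in> N"
    and ex: "r0 \<in> N" "r0 *s v \<noteq> 0"
  shows "\<exists>r\<in>N. r *s v = b"
proof -
  have "0 \<in> N" using mult[OF ex(1), of 0] by simp
  have "submodule ((\<lambda>r. r *s v) ` N)"
    unfolding submodule_def
  proof (intro conjI ballI allI)
    show "0 \<in> (\<lambda>r. r *s v) ` N" using \<open>0 \<in> N\<close> by (force simp: scale_zero_left)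
    fix x y assume "x \<in> (\<lambda>r. r *s v) ` N" "y \<in> (\<lambda>r. r *s v) ` N"
    then show "x + y \<in> (\<lambda>r. r *s v) ` N"
      using add by (auto simp: scale_left_distrib[symmetric])
  next
    fix r x assume "x \<in> (\<lambda>r. r *s v) ` N"
    then show "r *s x \<in> (\<lambda>r. r *s v) ` N" using mult by (auto simp: scale_scale)
  qed
  then have "(\<lambda>r. r *s v) ` N = UNIV" using simple ex by blast
  then show ?thesis by (metis UNIV_I imageE)
qed

lemma annihilator_transitive:
  assumes "\<forall>v\<in>F. r0 *s v = 0" "r0 *s a \<noteq> 0"
  shows "\<exists>r. (\<forall>v\<in>F. r *s v = 0) \<and> r *s a = b"
  using left_ideal_transitive[of "{r. \<forall>v\<in>F. r *s v = 0}" r0 a b] assms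
  by (auto simp: scale_left_distrib scale_scale[symmetric] scale_zero_right)

text \<open>The annihilator step of Jacobson density, by induction on \<open>F\<close>: if some
  scalar kills \<open>F\<close> but not \<open>v\<close>, there is an endomorphism \<open>d\<close>
  such that every scalar killing \<open>F\<close> also kills \<open>a - d v\<close>.\<close>

lemma mem_of_annihilated:
  assumes V: "endo_subspace V" and "finite F" "F \<subseteq> V"
    and "\<And>r. \<forall>v\<in>F. r *s v = 0 \<Longrightarrow> r *s a = 0"
  shows "a \<in> V"
  using assms(2-)
proof (induction F arbitrary: a rule: finite_induct)
  case empty
  have "1 *s a = 0" using empty.prems(2) by blast
  then have "a = 0" by (simp add: scale_one)
  then show ?case using V by (simp add: endo_subspace_def)
next
  case (insert v F)
  show ?case
  proof (cases "\<exists>r0. (\<forall>u\<in>F. r0 *s u = 0) \<and> r0 *s v \<noteq> 0")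
    case False
    then show ?thesis using insert.prems by (intro insert.IH) auto
  next
    case True
    let ?N = "\<lambda>r. \<forall>u\<in>F. r *s u = 0"
    have ex: "\<exists>r. ?N r \<and> r *s v = b" for b
      using annihilator_transitive True by blast
    have wd: "r *s a = s *s a" if "?N r" "?N s" "r *s v = s *s v" for r s
      using insert.prems(2)[of "r - s"] that by (auto simp: scale_diff_left)
    \<comment> \<open>the endomorphism sending \<open>r *s v\<close> to \<open>r *s a\<close> for all \<open>r\<close> annihilating \<open>F\<close>\<close>
    define d where "d b = (SOME r. ?N r \<and> r *s v = b) *s a" for b
    have d: "d (r *s v) = r *s a" if "?N r" for r
      using someI[of "\<lambda>s. ?N s \<and> s *s v = r *s v" r] that
      unfolding d_def by (intro wd) auto
    have "d \<in> endos"
      unfolding endos_def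
    proof (intro CollectI conjI allI)
      fix x y
      obtain r s where "?N r" "r *s v = x" "?N s" "s *s v = y" using ex by blast
      then show "d (x + y) = d x + d y"
        using d[of r] d[of s] d[of "r + s"] by (auto simp: scale_left_distrib)
    next
      fix q x
      obtain r where "?N r" "r *s v = x" using ex by blast
      then show "d (q *s x) = q *s d x"
        using d[of r] d[of "q * r"] by (auto simp: scale_scale[symmetric] scale_zero_right)
    qed
    have "a - d v \<in> V"
    proof (rule insert.IH)
      show "F \<subseteq> V" using insert by auto
      fix r assume "?N r"
      then show "r *s (a - d v) = 0"
        using d[of r] endos_scale[OF \<open>d \<in> endos\<close>] by (simp add: scale_diff_right)
    qed
    moreover have "d v \<in> V" using V insert.prems \<open>d \<in> endos\<close> by (auto simp: endo_subspace_def)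
    ultimately have "(a - d v) + d v \<in> V" using V unfolding endo_subspace_def by blast
    then show ?thesis by simp
  qed
qed

text \<open>By \<open>ker\<close>, the assignment \<open>t *s w \<mapsto> g w\<close> is well
  defined. Density realizes it by a scalar on finite sets, and one finite set of representatives
  covers the finite image of \<open>W\<close>.\<close>

lemma endo_linear_factor:
  assumes W: "endo_subspace W" and g: "endo_linear g"
    and ker: "\<And>w. w \<in> W \<Longrightarrow> t *s w = 0 \<Longrightarrow> g w = 0"
    and fin: "finite ((\<lambda>w. t *s w) ` W)"
  shows "\<exists>r. \<forall>w\<in>W. g w = r *s t *s w"
proof -
  have diff: "x - y \<in> W" if "x \<in> W" "y \<in> W" for x y
  proof -
    have "uminus \<in> endos" by (auto simp: endos_def scale_minus_right)
    then have "x + - y \<in> W" using W that unfolding endo_subspace_def by blast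
    then show ?thesis by simp
  qed
  have eq: "g x = g y" if "x \<in> W" "y \<in> W" "t *s x = t *s y" for x y
    using ker[OF diff[OF that(1,2)]] that(3) by (simp add: scale_diff_right endo_linear_diff[OF g])
  have ex: "\<exists>r. \<forall>w\<in>F. g w = r *s t *s w" if "finite F" "F \<subseteq> W" for F
    using that
  proof (induction F rule: finite_induct)
    case empty
    then show ?case by simp
  next
    case (insert w F)
    then obtain r0 where r0: "\<forall>w\<in>F. g w = r0 *s t *s w" by auto
    show ?case
    proof (cases "\<exists>r1. (\<forall>v\<in>(\<lambda>w. t *s w) ` F. r1 *s v = 0) \<and> r1 *s t *s w \<noteq> 0")
      case True
      \<comment> \<open>The correction \<open>r\<close> leaves the earlier points alone and removes
        the error of \<open>r0\<close> at \<open>w\<close>.\<close>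
      then obtain r where "\<forall>v\<in>(\<lambda>w. t *s w) ` F. r *s v = 0" "r *s t *s w = g w - r0 *s t *s w"
        using annihilator_transitive by meson
      then show ?thesis using r0 by (intro exI[of _ "r0 + r"]) (auto simp: scale_left_distrib)
    next
      case False
      \<comment> \<open>\<open>?V\<close> contains \<open>t *s v\<close> for all \<open>v\<close> in
        \<open>F\<close>, so density puts \<open>t *s w\<close> into it. Thus \<open>r0\<close> is
        already right at some \<open>w'\<close> with the same \<open>t\<close>-multiple as
        \<open>w\<close>, hence at \<open>w\<close>.\<close>
      let ?V = "(\<lambda>w. t *s w) ` {w \<in> W. g w = r0 *s t *s w}"
      have "endo_subspace {w \<in> W. g w = r0 *s t *s w}"
        using W g by (auto simp: endo_subspace_def endo_linear_zero scale_zero_right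
            endo_linear_add endo_linear_endo scale_right_distrib endos_scale)
      then have "endo_subspace ?V"
        unfolding endo_subspace_def
        by (auto simp: scale_right_distrib[symmetric] endos_scale
            intro!: image_eqI[where f = "\<lambda>w. t *s w"] intro: scale_zero_right[symmetric])
      then have "t *s w \<in> ?V"
        by (rule mem_of_annihilated[where F = "(\<lambda>w. t *s w) ` F"])
          (use insert r0 False in auto)
      then obtain w' where "w' \<in> W" "g w' = r0 *s t *s w'" "t *s w = t *s w'" by blast
      then have "g w = r0 *s t *s w" using eq[of w w'] insert by auto
      then show ?thesis using r0 by auto
    qed
  qed
  obtain F where F: "F \<subseteq> W" "finite F" "(\<lambda>w. t *s w) ` W = (\<lambda>w. t *s w) ` F"
    using finite_subset_image[OF fin, of "\<lambda>w. t *s w" W] by auto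
  obtain r where r: "\<forall>w\<in>F. g w = r *s t *s w" using ex F by blast
  have "g w = r *s t *s w" if "w \<in> W" for w
  proof -
    have "t *s w \<in> (\<lambda>w. t *s w) ` F" using F(3) that by blast
    then obtain w' where "w' \<in> F" "t *s w = t *s w'" by blast
    then show ?thesis using eq[of w w'] that F(1) r by auto
  qed
  then show ?thesis by blast
qed

text \<open>On the common kernel of \<open>S\<close> the map \<open>g\<close> factors through
  \<open>t\<close>; subtracting the resulting \<open>r * t\<close> leaves a map vanishing on that
  kernel, to which the induction hypothesis applies.\<close>

lemma endo_linear_vanishing_on_kernels:
  assumes "finite S" "\<And>s. s \<in> S \<Longrightarrow> finite (range (\<lambda>x. s *s x))"
    and "endo_linear g" "\<And>x. \<forall>s\<in>S. s *s x = 0 \<Longrightarrow> g x = 0"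
  shows "\<exists>r. \<forall>x. g x = r *s x"
  using assms
proof (induction S arbitrary: g rule: finite_induct)
  case empty
  then show ?case by (intro exI[of _ 0]) (auto simp: scale_zero_left)
next
  case (insert t S)
  let ?W = "{x. \<forall>s\<in>S. s *s x = 0}"
  have "endo_subspace ?W"
    by (auto simp: endo_subspace_def scale_zero_right scale_right_distrib
        endos_scale[symmetric] endos_zero)
  moreover have "finite ((\<lambda>w. t *s w) ` ?W)"
    by (rule finite_subset[OF _ insert.prems(1)[of t]]) auto
  ultimately obtain r where r: "\<forall>w\<in>?W. g w = r *s t *s w"
    using endo_linear_factor[of ?W g t] insert.prems by auto
  have "\<exists>r'. \<forall>x. g x - (r * t) *s x = r' *s x"
    by (rule insert.IH) (use insert.prems r in \<open>auto simp: endo_linear_minus_scale scale_scale\<close>)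
  then obtain r' where "\<forall>x. g x - (r * t) *s x = r' *s x" by blast
  then show ?case
    by (intro exI[of _ "r' + r * t"]) (simp add: scale_left_distrib diff_eq_eq)
qed


section \<open>Uniform interpolation\<close>

lemma unary_uniform_interpolation:
  assumes "finite T"
    and interp: "\<And>x y z. \<exists>r\<in>T. f x = r *s x \<and> f y = r *s y \<and> f z = r *s z"
  shows "\<exists>r. \<forall>x. f x = r *s x"
proof -
  have f: "endo_linear f"
    unfolding endo_linear_def
  proof (intro conjI allI ballI)
    fix x y
    show "f (x + y) = f x + f y"
      using interp[of x y "x + y"] by (auto simp: scale_right_distrib)
  next
    fix d x assume "d \<in> endos"
    then show "f (d x) = d (f x)" using interp[of x "d x" x] by (auto simp: endos_scale)
  qed
  define K where "K s = {x. f x = s *s x}" for s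
  let ?P = "\<lambda>T'. T' \<subseteq> T \<and> (\<Union>s\<in>T'. K s) = UNIV"
  have "?P T" using interp by (fastforce simp: K_def)
  \<comment> \<open>Least cardinality among the subcovers gives irredundancy.\<close>
  then obtain T' where T': "?P T'" and min: "\<And>T''. ?P T'' \<Longrightarrow> card T' \<le> card T''"
    using arg_min_natI[of ?P T card] arg_min_nat_le[of ?P _ card] by blast
  have finT': "finite T'" using T' assms(1) finite_subset by blast
  have "\<exists>F. finite F \<and> (\<forall>x. \<exists>y\<in>F. x - y \<in> (\<Inter>s\<in>T'. K s))"
  proof (rule irredundant_cover_Inter_finite_index[OF finT'])
    show "(\<Union>s\<in>T'. K s) = UNIV" using T' by blast
    fix T'' assume "T'' \<subset> T'"
    then have "card T'' < card T'" using finT' psubset_card_mono by blast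
    then show "(\<Union>s\<in>T''. K s) \<noteq> UNIV" using min[of T''] T' \<open>T'' \<subset> T'\<close> by auto
  qed (auto simp: K_def endo_linear_zero[OF f] endo_linear_diff[OF f] scale_zero_right
      scale_diff_right)
  then obtain F where F: "finite F" "\<And>x. \<exists>y\<in>F. x - y \<in> (\<Inter>s\<in>T'. K s)" by blast
  obtain r0 where r0: "r0 \<in> T'" using T' by auto
  have "\<exists>r. \<forall>x. f x - r0 *s x = r *s x"
  proof (rule endo_linear_vanishing_on_kernels[of "(\<lambda>s. s - r0) ` T'"])
    show "endo_linear (\<lambda>x. f x - r0 *s x)" by (rule endo_linear_minus_scale[OF f])
  next
    fix s assume "s \<in> (\<lambda>s. s - r0) ` T'"
    then obtain u where u: "u \<in> T'" "s = u - r0" by blast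
    \<comment> \<open>Both \<open>u\<close> and \<open>r0\<close> represent \<open>f\<close> on the
      intersection of the \<open>K s\<close>, so \<open>s\<close> kills it and takes all its values
      on the coset representatives \<open>F\<close>.\<close>
    have "range (\<lambda>x. s *s x) \<subseteq> (\<lambda>x. s *s x) ` F"
    proof (intro image_subsetI)
      fix x
      obtain y where y: "y \<in> F" "x - y \<in> (\<Inter>s\<in>T'. K s)" using F(2) by blast
      then have "f (x - y) = u *s (x - y)" "f (x - y) = r0 *s (x - y)"
        using u r0 unfolding K_def by blast+
      then have "s *s (x - y) = 0" using u by (simp add: scale_diff_left)
      then show "s *s x \<in> (\<lambda>x. s *s x) ` F" using y(1) by (simp add: scale_diff_right)
    qed
    then show "finite (range (\<lambda>x. s *s x))" using F(1) finite_subset by blast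
  next
    fix x assume x: "\<forall>s\<in>(\<lambda>s. s - r0) ` T'. s *s x = 0"
    obtain u where "u \<in> T'" "x \<in> K u" using T' by blast
    then show "f x - r0 *s x = 0" using x by (auto simp: K_def scale_diff_left)
  qed (use finT' in auto)
  then obtain r where "\<forall>x. f x - r0 *s x = r *s x" by blast
  then show ?thesis
    by (intro exI[of _ "r + r0"]) (simp add: scale_left_distrib diff_eq_eq)
qed

text \<open>Additivity splits \<open>f\<close> over the coordinate axes, where the unary case
  applies. Points are functions on all of \<open>nat\<close>, but \<open>lin\<close> reads only the
  first \<open>n\<close> entries.\<close>

lemma uniform_interpolation:
  fixes f :: "(nat \<Rightarrow> 'a) \<Rightarrow> 'a" and T :: "(nat \<Rightarrow> 'r) set" and n :: nat
  defines "lin \<equiv> \<lambda>r x. \<Sum>i<n. r i *s x i"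
  assumes "finite T"
    and interp: "\<And>x y z. \<exists>r\<in>T. f x = lin r x \<and> f y = lin r y \<and> f z = lin r z"
  shows "\<exists>r. \<forall>x. f x = lin r x"
proof -
  define \<delta> where "\<delta> i a = (\<lambda>j::nat. if j = i then a else 0)" for i and a :: 'a
  have lin_\<delta>: "lin r (\<delta> i a) = r i *s a" if "i < n" for r i a
  proof -
    have "lin r (\<delta> i a) = (\<Sum>j<n. if j = i then r i *s a else 0)"
      unfolding lin_def \<delta>_def by (rule sum.cong) (auto simp: scale_zero_right)
    then show ?thesis using that by simp
  qed
  have add: "f (\<lambda>i. x i + y i) = f x + f y" for x y
    using interp[of x y "\<lambda>i. x i + y i"]
    by (auto simp: lin_def scale_right_distrib sum.distrib)
  have coord: "\<exists>q. \<forall>a. f (\<delta> i a) = q *s a" if "i < n" for i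
  proof (rule unary_uniform_interpolation[of "(\<lambda>r. r i) ` T"])
    show "\<exists>r\<in>(\<lambda>r. r i) ` T. f (\<delta> i x) = r *s x \<and> f (\<delta> i y) = r *s y \<and> f (\<delta> i z) = r *s z"
      for x y z using interp[of "\<delta> i x" "\<delta> i y" "\<delta> i z"] lin_\<delta>[OF that] by auto
  qed (use \<open>finite T\<close> in auto)
  then obtain q where q: "\<And>i a. i < n \<Longrightarrow> f (\<delta> i a) = q i *s a" by metis
  have "f x = lin q x" for x
  proof -
    have "m \<le> n \<Longrightarrow> f (\<lambda>i. if i < m then x i else 0) = (\<Sum>i<m. q i *s x i)" for m
    proof (induction m)
      case 0
      then show ?case using add[of "\<lambda>_. 0" "\<lambda>_. 0"] by simp
    next
      case (Suc m)
      have "(\<lambda>i. if i < Suc m then x i else 0) =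
          (\<lambda>i. (if i < m then x i else 0) + \<delta> m (x m) i)"
        by (auto simp: \<delta>_def less_Suc_eq)
      then show ?case using Suc add[of "\<lambda>i. if i < m then x i else 0" "\<delta> m (x m)"] q[of m] by simp
    qed
    from this[of n] have "f (\<lambda>i. if i < n then x i else 0) = lin q x" by (simp add: lin_def)
    \<comment> \<open>One \<open>r\<close> interpolates both at \<open>x\<close> and at its
      truncation, and \<open>lin r\<close> does not distinguish them.\<close>
    moreover have "f (\<lambda>i. if i < n then x i else 0) = f x"
      using interp[of x "\<lambda>i. if i < n then x i else 0" x] by (auto simp: lin_def)
    ultimately show ?thesis by simp
  qed
  then show ?thesis by blast
qed

end


section \<open>Ultrainterpolable operations are uniformly interpolable\<close>

lemma finite_card_of_ordLeq:
  assumes "finite A" "finite B"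
  shows "|A| \<le>o |B| \<longleftrightarrow> card A \<le> card B"
  using assms by (simp add: card_of_ordLeq[symmetric] inj_on_iff_card_le)

lemma (in left_module) module_clone_operations:
  "(n, f) \<in> module_clone scale \<Longrightarrow> f \<in> operations UNIV n"
  by (auto simp: module_clone_iff operations_def)

text \<open>If no finite \<open>T\<close> works, the sets of triples where a given \<open>r\<close>
  fails have the finite intersection property. Over an ultrafilter containing them, the three
  projections form a generic triple that no term interpolates.\<close>

lemma (in left_module) ultrainterpolable_imp_uniform:
  fixes f :: "'a list \<Rightarrow> 'a" and n :: nat
  defines "F \<equiv> \<lambda>x. f (map x [0..<n])"
    and "lin \<equiv> \<lambda>r x. \<Sum>i<n. r i *s x i"
  assumes f: "f \<in> operations UNIV n"
    and ui: "ultrainterpolable TYPE((nat \<Rightarrow> 'a) \<times> (nat \<Rightarrow> 'a) \<times> (nat \<Rightarrow> 'a))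
      |{..<3::nat}| UNIV (module_clone scale) n f"
  shows "\<exists>T. finite T \<and> (\<forall>x y z. \<exists>r\<in>T. F x = lin r x \<and> F y = lin r y \<and> F z = lin r z)"
proof (rule ccontr)
  assume neg: "\<not> ?thesis"
  define good where
    "good r = {(x, y, z). F x = lin r x \<and> F y = lin r y \<and> F z = lin r z}" for r
  have "fip (range (\<lambda>r. - good r))"
    unfolding fip_def
  proof (intro allI impI, elim conjE)
    fix H assume "finite H" "H \<subseteq> range (\<lambda>r. - good r)"
    then obtain T where T: "finite T" "H = (\<lambda>r. - good r) ` T" by (meson finite_subset_image)
    then obtain x y z where "\<forall>r\<in>T. (x, y, z) \<notin> good r" using neg by (auto simp: good_def)
    then show "\<Inter>H \<noteq> {}" using T by auto
  qed
  then obtain U where bad: "\<And>r. - good r \<in> U" and U: "ultrafilter_on UNIV U"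
    using fip_extends_to_ultrafilter by (metis range_subsetD)
  let ?R = "ultra_rel UNIV U (UNIV :: 'a set)"
  \<comment> \<open>Evaluated at the index \<open>p\<close>, \<open>tup k\<close> lists the first
    \<open>n\<close> entries of \<open>k p\<close>; the three projections as \<open>k\<close> give
    the generic points.\<close>
  define tup where "tup k = map (\<lambda>i p. k p i) [0..<n]"
    for k :: "(nat \<Rightarrow> 'a) \<times> (nat \<Rightarrow> 'a) \<times> (nat \<Rightarrow> 'a) \<Rightarrow> nat \<Rightarrow> 'a"
  define cls where "cls k = map (\<lambda>a. ?R `` {a}) (tup k)" for k
  have tup: "tup k \<in> tuples (UNIV \<rightarrow>\<^sub>E UNIV) n" for k by (auto simp: tup_def tuples_def)
  have tup_at: "map (\<lambda>a. a p) (tup k) = map (k p) [0..<n]" for k p by (simp add: tup_def)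
  have cls: "cls k \<in> tuples (ultrapower UNIV U UNIV) n" for k
    using tup[of k] by (auto simp: cls_def tuples_def ultrapower_def intro: quotientI)
  let ?S = "{cls fst, cls (\<lambda>p. fst (snd p)), cls (\<lambda>p. snd (snd p))}"
  \<comment> \<open>The three classes may coincide, as for \<open>n = 0\<close>.\<close>
  have "|?S| \<le>o |{..<3::nat}|"
    by (simp add: finite_card_of_ordLeq card_insert_if)
  moreover have "?S \<subseteq> tuples (ultrapower UNIV U UNIV) n" using cls by auto
  ultimately obtain t' where "(n, t') \<in> ultra_ops UNIV U UNIV (module_clone scale)"
    and "\<forall>Qs\<in>?S. ultra_op UNIV U UNIV n f Qs = t' Qs"
    using ui U unfolding ultrainterpolable_def interpolable_def by (metis UNIV_not_empty)
  then obtain t where tC: "(n, t) \<in> module_clone scale"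
    and t: "\<forall>Qs\<in>?S. ultra_op UNIV U UNIV n f Qs = ultra_op UNIV U UNIV n t Qs"
    by (auto simp: ultra_ops_def)
  obtain r where r: "t = (\<lambda>xs\<in>tuples UNIV n. \<Sum>i<n. r i *s (xs ! i))"
    using tC by (auto simp: module_clone_iff)
  have t_eq: "t (map x [0..<n]) = lin r x" for x
    unfolding r lin_def by (simp add: tuples_def)
  have agree: "{p. F (k p) = lin r (k p)} \<in> U" if "cls k \<in> ?S" for k
    using ultra_op_eq_iff[OF U f module_clone_operations[OF tC] tup[of k]] t[rule_format, OF that]
    unfolding cls_def tup_at t_eq by (simp add: F_def)
  have "{p. F (fst p) = lin r (fst p)} \<inter> {p. F (fst (snd p)) = lin r (fst (snd p))} \<inter>
      {p. F (snd (snd p)) = lin r (snd (snd p))} \<inter> - good r \<in> U"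
    (is "?X \<in> U")
    by (intro ultrafilter_onD(4)[OF U] agree bad) auto
  moreover have "?X = {}" by (auto simp: good_def)
  ultimately show False using ultrafilter_onD(3)[OF U] by simp
qed

section \<open>Closedness of the clone for all cardinals above three\<close>

lemma clone_subset_Upsilon:
  assumes "\<And>n f. (n, f) \<in> C \<Longrightarrow> f \<in> operations A n"
  shows "C \<subseteq> Upsilon ind \<kappa> A C"
  using assms
  by (auto simp: Upsilon_def ultrainterpolable_def interpolable_def ultra_ops_def)

text \<open>Interpolation at three points already forces membership in the clone, so one argument
  serves both \<open>4\<close> and \<open>natLeq\<close>.\<close>

lemma (in simple_left_module) ultraclosed_module_clone:
  fixes \<kappa> :: "nat rel"
  assumes large: "|UNIV :: 'a list set| \<le>o |UNIV :: 'i set|" and \<kappa>: "|{..<3::nat}| <o \<kappa>"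
  shows "ultraclosed TYPE('i) \<kappa> UNIV (module_clone scale)"
  unfolding ultraclosed_def
proof (intro equalityI subsetI)
  fix p assume "p \<in> Upsilon TYPE('i) \<kappa> UNIV (module_clone scale)"
  then obtain n f where p: "p = (n, f)" and f: "f \<in> operations UNIV n"
    and ui: "ultrainterpolable TYPE('i) |{..<3::nat}| UNIV (module_clone scale) n f"
    using \<kappa> card_of_Card_order[of "{..<3::nat}"] unfolding Upsilon_def by blast
  \<comment> \<open>The compactness argument takes triples as indices; \<open>large\<close> permits
    the change from \<open>'i\<close> to that type.\<close>
  have "\<exists>T. finite T \<and> (\<forall>x y z. \<exists>r\<in>T. f (map x [0..<n]) = (\<Sum>i<n. r i *s x i) \<and>
      f (map y [0..<n]) = (\<Sum>i<n. r i *s y i) \<and> f (map z [0..<n]) = (\<Sum>i<n. r i *s z i))"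
    by (rule ultrainterpolable_imp_uniform[OF f],
        rule ultrainterpolable_index_type[OF large _ _ module_clone_operations f ui])
      (auto simp: card_of_card_order_on Field_card_of)
  then obtain r where r: "\<And>x. f (map x [0..<n]) = (\<Sum>i<n. r i *s x i)"
    using uniform_interpolation[of _ "\<lambda>x. f (map x [0..<n])" n] by blast
  have "f = (\<lambda>xs\<in>tuples UNIV n. \<Sum>i<n. r i *s (xs ! i))"
  proof
    fix xs
    show "f xs = (\<lambda>xs\<in>tuples UNIV n. \<Sum>i<n. r i *s (xs ! i)) xs"
    proof (cases "xs \<in> tuples UNIV n")
      case True
      then have "map ((!) xs) [0..<n] = xs" by (auto simp: tuples_def map_nth)
      then show ?thesis using r[of "(!) xs"] True by simp
    next
      case False
      then show ?thesis using f by (auto simp: operations_def PiE_def extensional_def)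
    qed
  qed
  then show "p \<in> module_clone scale" unfolding p module_clone_iff by blast
next
  fix p assume "p \<in> module_clone scale"
  then show "p \<in> Upsilon TYPE('i) \<kappa> UNIV (module_clone scale)"
    using clone_subset_Upsilon[of "module_clone scale"] module_clone_operations by blast
qed

theorem theorem5p1:
  fixes scale :: "'r::ring_1 \<Rightarrow> 'a::ab_group_add \<Rightarrow> 'a"
  assumes "simple_left_module scale"
    and "|UNIV :: 'a list set| \<le>o |UNIV :: 'i set|"
  shows "ultraclosed TYPE('i) |{..<4::nat}| UNIV (module_clone scale) \<and>
    ultralocally_closed TYPE('i) UNIV (module_clone scale)"
proof -
  interpret simple_left_module scale by fact
  have "|{..<3::nat}| <o |{..<4::nat}|"
    by (simp add: not_ordLeq_iff_ordLess[symmetric] card_of_Well_order finite_card_of_ordLeq)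
  moreover have "|{..<3::nat}| <o natLeq"
    by (metis finite_iff_ordLess_natLeq finite_lessThan)
  ultimately show ?thesis
    using ultraclosed_module_clone[OF assms(2)] by (simp add: ultralocally_closed_def)
qed

end
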